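(* Let $X$ be a separable metrizable space with topology $\tau$, and let $\mathcal{B}\in\{\Lambda,\Omega\}$. Assume that $X$ satisfies $\mathsf{S}_{\mathrm{fin}}(\Omega,\mathcal{B})$, and consider $\tau$ as a semigroup with the operation $\cup$. Then for every coloring of $[\tau]^2$ and every family $\mathcal{U}\in\Omega$ with no finite subcover, there are pairwise disjoint sets $\mathcal{F}_1,\mathcal{F}_2,\dotsc\in\mathrm{Fin}(\mathcal{U})$ such that: (1) the family $\bigcup_{n\in\mathbb{N}}\mathcal{F}_n$ is in $\mathcal{B}$; (2) the sequence $\bigcup\mathcal{F}_1,\bigcup\mathcal{F}_2,\dotsc$ is proper; (3) the sumgraph of the sequence $\bigcup\mathcal{F}_1,\bigcup\mathcal{F}_2,\dotsc$ is monochromatic.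
   Context: By a space we mean an infinite Tychonoff topological space. A cover of a space is a family of nonempty proper subsets of the space whose union is the whole space. An $\omega$-cover is a cover such that each finite subset of the space is contained in some member of the cover; a large cover is a cover such that each point belongs to infinitely many members. $\Omega$ and $\Lambda$ denote the families of all open $\omega$-covers and of all open large covers of $X$, respectively. $\mathsf{S}_{\mathrm{fin}}(\mathcal{A},\mathcal{B})$: for each sequence $A_1,A_2,\dotsc\in\mathcal{A}$ there are finite sets $F_1\subseteq A_1,F_2\subseteq A_2,\dotsc$ such that $\bigcup_{n\in\mathbb{N}}F_n\in\mathcal{B}$. For a set $A$, $\mathrm{Fin}(A)$ is the family of all finite nonempty subsets of $A$ and $[A]^2$ the family of all two-element subsets of $A$. A coloring of a nonempty set $Z$ is a function $\chi\colon Z\to\{1,\dotsc,k\}$ with $k$ a natural number; a subset of $Z$ is monochromatic if $\chi$ is constant on it. For $H_1,H_2\in\mathrm{Fin}(\mathbb{N})$ write $H_1<H_2$ if $\max H_1<\min H_2$. For a sequence $V_1,V_2,\dotsc$ in the semigroup $(\tau,\cup)$ and $H\in\mathrm{Fin}(\mathbb{N})$, let $V_H:=\bigcup_{i\in H}V_i$. The sequence is proper if $V_{H_1}\neq V_{H_2}$ for all $H_1<H_2$ in $\mathrm{Fin}(\mathbb{N})$; its sumgraph is then $\{\{V_{H_1},V_{H_2}\}: H_1,H_2\in\mathrm{Fin}(\mathbb{N}),\ H_1<H_2\}$. *)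

theory Defs
  imports "HOL-Analysis.Analysis" "HOL-Library.Ramsey"
begin

definition is_cover :: "'a topology \<Rightarrow> 'a set set \<Rightarrow> bool" where
  "is_cover X \<U> \<longleftrightarrow>
     (\<forall>U\<in>\<U>. U \<noteq> {} \<and> U \<subset> topspace X) \<and> \<Union>\<U> = topspace X"

definition open_omega_covers :: "'a topology \<Rightarrow> 'a set set set" where
  "open_omega_covers X =
     {\<U>. is_cover X \<U> \<and> (\<forall>U\<in>\<U>. openin X U) \<and>
          (\<forall>S. finite S \<and> S \<subseteq> topspace X \<longrightarrow> (\<exists>U\<in>\<U>. S \<subseteq> U))}"

definition open_large_covers :: "'a topology \<Rightarrow> 'a set set set" where
  "open_large_covers X =
     {\<U>. is_cover X \<U> \<and> (\<forall>U\<in>\<U>. openin X U) \<and>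
          (\<forall>x\<in>topspace X. infinite {U\<in>\<U>. x \<in> U})}"

text \<open>The finite sets \<open>F n\<close> chosen by the selection principle may be empty.\<close>

definition S_fin :: "'b set set \<Rightarrow> 'b set set \<Rightarrow> bool" where
  "S_fin \<A> \<B> \<longleftrightarrow>
     (\<forall>A :: nat \<Rightarrow> 'b set. (\<forall>n. A n \<in> \<A>) \<longrightarrow>
        (\<exists>F :: nat \<Rightarrow> 'b set. (\<forall>n. finite (F n) \<and> F n \<subseteq> A n) \<and> (\<Union>n. F n) \<in> \<B>))"

definition Fin :: "'b set \<Rightarrow> 'b set set" where
  "Fin A = {H. H \<subseteq> A \<and> finite H \<and> H \<noteq> {}}"

definition coloring :: "'b set \<Rightarrow> nat \<Rightarrow> ('b \<Rightarrow> nat) \<Rightarrow> bool" where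
  "coloring Z k \<gamma> \<longleftrightarrow> \<gamma> ` Z \<subseteq> {1..k}"

definition monochromatic_subset :: "'b set \<Rightarrow> ('b \<Rightarrow> nat) \<Rightarrow> 'b set \<Rightarrow> bool" where
  "monochromatic_subset Z \<gamma> S \<longleftrightarrow> S \<subseteq> Z \<and> \<gamma> constant_on S"

text \<open>The order on blocks; meaningful for finite nonempty sets only.\<close>

definition block_less :: "nat set \<Rightarrow> nat set \<Rightarrow> bool" where
  "block_less H\<^sub>1 H\<^sub>2 \<longleftrightarrow> Max H\<^sub>1 < Min H\<^sub>2"

definition block_union :: "(nat \<Rightarrow> 'a set) \<Rightarrow> nat set \<Rightarrow> 'a set" where
  "block_union V H = (\<Union>i\<in>H. V i)"

definition proper_seq :: "(nat \<Rightarrow> 'a set) \<Rightarrow> bool" where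
  "proper_seq V \<longleftrightarrow>
     (\<forall>H\<^sub>1\<in>Fin UNIV. \<forall>H\<^sub>2\<in>Fin UNIV. block_less H\<^sub>1 H\<^sub>2 \<longrightarrow> block_union V H\<^sub>1 \<noteq> block_union V H\<^sub>2)"

definition sumgraph :: "(nat \<Rightarrow> 'a set) \<Rightarrow> 'a set set set" where
  "sumgraph V =
     {{block_union V H\<^sub>1, block_union V H\<^sub>2} | H\<^sub>1 H\<^sub>2.
        H\<^sub>1 \<in> Fin UNIV \<and> H\<^sub>2 \<in> Fin UNIV \<and> block_less H\<^sub>1 H\<^sub>2}"

end

theory Submission
  imports Defs
begin

text \<open>A countable \<open>\<omega>\<close>-subcover \<open>U 0, U 1, \<dots>\<close> of the given cover turns the coloring of \<open>[\<tau>]\<^sup>2\<close> into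
  a coloring of pairs of finite sets of naturals. The Milliken--Taylor argument is run with an
  idempotent ultrafilter \<open>p\<close> on the finite sets of naturals (with union) whose members \<open>A\<close> all have
  the property that, for some \<open>m\<close> and every \<open>j\<close>, some element of \<open>A\<close> contains \<open>{m..<j}\<close>; such
  ultrafilters form a closed ideal, so Ellis' theorem provides one. Hence at each step of the
  construction of a monochromatic block sequence the next block may swallow an arbitrarily long
  interval \<open>{m..<j}\<close>. As \<open>m\<close> depends only on the finitely many positions reachable so far, the
  choice of all \<open>j\<close> reduces to a single sequence of covers, and \<open>S_fin\<close> selects the
  lengths so that the blocks together still form a cover in \<open>\<B>\<close>. Pairs violating properness get an
  extra color; it cannot be the color of the sequence, since then all blocks would have the same
  union and the finitely many sets of a single block would cover the space.\<close>

section \<open>Idempotent ultrafilters\<close>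

definition ultra_filter :: "'a filter \<Rightarrow> bool" where
  "ultra_filter F \<longleftrightarrow> F \<noteq> bot \<and> (\<forall>P. eventually P F \<or> eventually (\<lambda>x. \<not> P x) F)"

text \<open>Zorn's lemma for proper filters: whatever holds eventually along the infimum of a chain
  already does so along a member, so the infimum stays proper. With trivial \<open>Q\<close> this
  yields ultrafilters, with closure under products it yields minimal closed subsemigroups.\<close>

lemma minimal_filter_exists:
  assumes F0: "F0 \<noteq> bot" "Q F0"
    and chain: "\<And>C. C \<noteq> {} \<Longrightarrow> (\<And>F. F \<in> C \<Longrightarrow> Q F) \<Longrightarrow>
      (\<And>P. eventually P (Inf C) \<longleftrightarrow> (\<exists>F\<in>C. eventually P F)) \<Longrightarrow> Q (Inf C)"
  obtains F where "F \<noteq> bot" "F \<le> F0" "Q F" "\<And>G. G \<noteq> bot \<Longrightarrow> G \<le> F \<Longrightarrow> Q G \<Longrightarrow> G = F"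
proof -
  define A where "A = {F. F \<noteq> bot \<and> F \<le> F0 \<and> Q F}"
  have "\<exists>m\<in>A. \<forall>a\<in>A. m \<ge> a \<longrightarrow> a = m"
  proof (rule predicate_Zorn)
    show "partial_order_on A (relation_of (\<lambda>x y. y \<le> x) A)"
      by (rule partial_order_on_relation_ofI) auto
  next
    fix C assume "C \<in> Chains (relation_of (\<lambda>x y. y \<le> x) A)"
    then have C: "C \<subseteq> A" "\<And>F G. F \<in> C \<Longrightarrow> G \<in> C \<Longrightarrow> F \<le> G \<or> G \<le> F"
      by (auto simp: Chains_def relation_of_def)
    show "\<exists>u\<in>A. \<forall>a\<in>C. u \<le> a"
    proof (cases "C = {}")
      case True
      then show ?thesis using F0 by (auto simp: A_def)
    next
      case False
      have ev: "eventually P (Inf C) \<longleftrightarrow> (\<exists>F\<in>C. eventually P F)" for P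
      proof (rule eventually_Inf_base[OF False])
        fix F G assume "F \<in> C" "G \<in> C"
        with C(2)[of F G] show "\<exists>x\<in>C. x \<le> inf F G" by (metis inf.orderE inf_commute order_refl)
      qed
      have "Inf C \<noteq> bot"
        unfolding trivial_limit_def ev using C(1) by (auto simp: A_def trivial_limit_def)
      moreover have "Inf C \<le> F0"
        using False C(1) by (auto simp: A_def intro: Inf_lower2)
      moreover have "Q (Inf C)"
        using chain[OF False _ ev] C(1) by (auto simp: A_def)
      ultimately show ?thesis by (auto simp: A_def intro: Inf_lower)
    qed
  qed
  then show ?thesis using that by (force simp: A_def)
qed

lemma ultra_filter_exists:
  assumes "F0 \<noteq> bot"
  obtains F where "ultra_filter F" "F \<le> F0"
proof -
  obtain F where F: "F \<noteq> bot" "F \<le> F0"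
    and min: "\<And>G. G \<noteq> bot \<Longrightarrow> G \<le> F \<Longrightarrow> True \<Longrightarrow> G = F"
    by (rule minimal_filter_exists[of F0 "\<lambda>_. True", OF assms]) auto
  have "eventually P F" if "\<not> eventually (\<lambda>x. \<not> P x) F" for P
  proof -
    have "inf F (principal {x. P x}) \<noteq> bot"
      using that by (simp add: trivial_limit_def eventually_inf_principal)
    then have "inf F (principal {x. P x}) = F" by (intro min) auto
    then have "F \<le> principal {x. P x}" by (metis inf.orderI)
    then show ?thesis by (simp add: le_principal)
  qed
  with F that show ?thesis unfolding ultra_filter_def by blast
qed

lemma ultra_filter_not:
  assumes "ultra_filter F"
  shows "eventually (\<lambda>x. \<not> P x) F \<longleftrightarrow> \<not> eventually P F"
proof
  assume "eventually (\<lambda>x. \<not> P x) F"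
  then show "\<not> eventually P F"
    using assms eventually_conj[of "\<lambda>x. \<not> P x" F P]
    by (auto simp: ultra_filter_def trivial_limit_def)
qed (use assms in \<open>auto simp: ultra_filter_def\<close>)

lemma ultra_filter_finite_coloring:
  assumes "ultra_filter F" "finite K" "eventually (\<lambda>x. c x \<in> K) F"
  obtains i where "i \<in> K" "eventually (\<lambda>x. c x = i) F"
proof (rule ccontr)
  assume "\<not> thesis"
  with that have "\<forall>i\<in>K. eventually (\<lambda>x. c x \<noteq> i) F"
    using ultra_filter_not[OF assms(1)] by blast
  then have "eventually (\<lambda>x. \<forall>i\<in>K. c x \<noteq> i) F"
    using assms(2) by (intro eventually_ball_finite)
  with assms(3) have "eventually (\<lambda>x. False) F"
    by eventually_elim auto
  then show False using assms(1) by (simp add: ultra_filter_def trivial_limit_def)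
qed

section \<open>Products of filters and Ellis' theorem\<close>

text \<open>The product of filters induced by a semigroup operation, as in the Stone--Cech
  compactification. A filter \<open>F\<close> with \<open>filter_mult f F F \<le> F\<close> encodes a closed
  subsemigroup of the Stone--Cech compactification.\<close>

definition filter_mult :: "('a \<Rightarrow> 'a \<Rightarrow> 'a) \<Rightarrow> 'a filter \<Rightarrow> 'a filter \<Rightarrow> 'a filter" where
  "filter_mult f F G = Abs_filter (\<lambda>P. eventually (\<lambda>a. eventually (\<lambda>b. P (f a b)) G) F)"

lemma eventually_filter_mult:
  "eventually P (filter_mult f F G) \<longleftrightarrow> eventually (\<lambda>a. eventually (\<lambda>b. P (f a b)) G) F"
  unfolding filter_mult_def
proof (rule eventually_Abs_filter, unfold_locales, goal_cases)
  case 1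
  then show ?case by simp
next
  case (2 P Q)
  then show ?case by (simp add: eventually_conj_iff)
next
  case (3 P Q)
  from 3(2) show ?case
    by (rule eventually_mono) (use 3(1) in \<open>auto elim: eventually_mono\<close>)
qed

lemma filter_mult_mono: "F \<le> F' \<Longrightarrow> G \<le> G' \<Longrightarrow> filter_mult f F G \<le> filter_mult f F' G'"
  unfolding le_filter_def eventually_filter_mult
  by (metis (mono_tags, lifting) eventually_mono)

lemma filter_mult_ne_bot: "F \<noteq> bot \<Longrightarrow> G \<noteq> bot \<Longrightarrow> filter_mult f F G \<noteq> bot"
  by (simp add: trivial_limit_def eventually_filter_mult)

lemma filter_mult_assoc:
  assumes "\<And>a b c. f (f a b) c = f a (f b c)"
  shows "filter_mult f (filter_mult f F G) H = filter_mult f F (filter_mult f G H)"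
  by (simp add: filter_eq_iff eventually_filter_mult assms)

text \<open>Ellis' theorem: a minimal closed subsemigroup \<open>F\<close> contains an ultrafilter \<open>q\<close>;
  by minimality both \<open>F q = F\<close> and \<open>{p. p q = q} = F\<close>, so that \<open>F\<close> consists of \<open>q\<close> alone.\<close>

lemma idempotent_ultra_filter:
  assumes assoc: "\<And>a b c. f (f a b) c = f a (f b c)"
    and F0: "F0 \<noteq> bot" "filter_mult f F0 F0 \<le> F0"
  obtains F where "ultra_filter F" "F \<le> F0" "filter_mult f F F \<le> F"
proof -
  obtain F where F: "F \<noteq> bot" "F \<le> F0" "filter_mult f F F \<le> F"
    and min: "\<And>G. G \<noteq> bot \<Longrightarrow> G \<le> F \<Longrightarrow> filter_mult f G G \<le> G \<Longrightarrow> G = F"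
  proof (rule minimal_filter_exists[of F0 "\<lambda>F. filter_mult f F F \<le> F", OF F0])
    fix C :: "'a filter set"
    assume C: "\<And>F. F \<in> C \<Longrightarrow> filter_mult f F F \<le> F"
      and ev: "\<And>P. eventually P (Inf C) \<longleftrightarrow> (\<exists>F\<in>C. eventually P F)"
    show "filter_mult f (Inf C) (Inf C) \<le> Inf C"
    proof (rule Inf_greatest)
      fix F assume "F \<in> C"
      then have "filter_mult f (Inf C) (Inf C) \<le> filter_mult f F F"
        by (intro filter_mult_mono Inf_lower)
      also have "\<dots> \<le> F" by (rule C[OF \<open>F \<in> C\<close>])
      finally show "filter_mult f (Inf C) (Inf C) \<le> F" .
    qed
  qed auto
  obtain q where q: "ultra_filter q" "q \<le> F" by (rule ultra_filter_exists[OF F(1)])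
  have q_ne: "q \<noteq> bot" using q(1) by (simp add: ultra_filter_def)
  \<comment> \<open>The product \<open>F q\<close> is again a subsemigroup inside \<open>F\<close>:
    \<open>(F q)(F q)\<close> lies in \<open>F (F q) = (F F) q\<close>, hence in
    \<open>F q\<close>.\<close>
  have Fq: "filter_mult f F q = F"
  proof (rule min)
    show "filter_mult f F q \<noteq> bot" by (rule filter_mult_ne_bot[OF F(1) q_ne])
    have "filter_mult f F q \<le> filter_mult f F F" by (rule filter_mult_mono[OF order_refl q(2)])
    also have "\<dots> \<le> F" by (rule F(3))
    finally have le: "filter_mult f F q \<le> F" .
    then show "filter_mult f F q \<le> F" .
    have "filter_mult f (filter_mult f F q) (filter_mult f F q)
        \<le> filter_mult f F (filter_mult f F q)"
      by (rule filter_mult_mono[OF le order_refl])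
    also have "\<dots> = filter_mult f (filter_mult f F F) q"
      by (rule filter_mult_assoc[OF assoc, symmetric])
    also have "\<dots> \<le> filter_mult f F q" by (rule filter_mult_mono[OF F(3) order_refl])
    finally show "filter_mult f (filter_mult f F q) (filter_mult f F q) \<le> filter_mult f F q" .
  qed
  define E where "E P = (\<lambda>a. eventually (\<lambda>b. P (f a b)) q)" for P
  have E_conj: "E (\<lambda>x. P x \<and> Q x) a \<longleftrightarrow> E P a \<and> E Q a" for P Q a
    by (simp add: E_def eventually_conj_iff)
  \<comment> \<open>\<open>G\<close> encodes \<open>{p. p q = q}\<close> within \<open>F\<close>: an
    ultrafilter below \<open>F\<close> lies below \<open>G\<close> exactly if it contains
    \<open>E A\<close> for every \<open>A\<close> in \<open>q\<close>, that is, if its product with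
    \<open>q\<close> is at most \<open>q\<close>.\<close>
  define G where "G = Abs_filter (\<lambda>R. \<exists>B A. eventually B F \<and> eventually A q \<and>
    (\<forall>x. B x \<longrightarrow> E A x \<longrightarrow> R x))"
  have evG: "eventually R G \<longleftrightarrow> (\<exists>B A. eventually B F \<and> eventually A q \<and>
    (\<forall>x. B x \<longrightarrow> E A x \<longrightarrow> R x))" for R
    unfolding G_def
  proof (rule eventually_Abs_filter, unfold_locales, goal_cases)
    case 1
    then show ?case by (auto intro: always_eventually)
  next
    case (2 R S)
    then obtain B A B' A' where
      "eventually B F \<and> eventually A q \<and> (\<forall>x. B x \<longrightarrow> E A x \<longrightarrow> R x)"
      "eventually B' F \<and> eventually A' q \<and> (\<forall>x. B' x \<longrightarrow> E A' x \<longrightarrow> S x)" by auto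
    then show ?case
      by (intro exI[of _ "\<lambda>x. B x \<and> B' x"] exI[of _ "\<lambda>x. A x \<and> A' x"])
        (auto simp: E_conj eventually_conj_iff)
  next
    case (3 R S)
    then show ?case by blast
  qed
  have "G = F"
  proof (rule min)
    \<comment> \<open>If \<open>B\<close> and \<open>E A\<close> were disjoint, \<open>A\<close>
      would fail along \<open>F q = F\<close>, hence along the finer filter \<open>q\<close>, which
      contains \<open>A\<close>.\<close>
    show "G \<noteq> bot"
    proof
      assume "G = bot"
      then obtain B A where BA: "eventually B F" "eventually A q" "\<And>x. B x \<Longrightarrow> \<not> E A x"
        using evG[of "\<lambda>_. False"] by auto
      have "eventually (\<lambda>a. eventually (\<lambda>b. \<not> A (f a b)) q) F"
        using BA(1)
      proof eventually_elim
        case (elim a)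
        then show ?case using BA(3) ultra_filter_not[OF q(1)] by (auto simp: E_def)
      qed
      then have "eventually (\<lambda>x. \<not> A x) (filter_mult f F q)"
        by (simp add: eventually_filter_mult)
      then have "eventually (\<lambda>x. \<not> A x) q"
        unfolding Fq using q(2) by (rule filter_leD[rotated])
      then show False using ultra_filter_not[OF q(1)] BA(2) by blast
    qed
    show GF: "G \<le> F"
    proof (rule filter_leI)
      fix P assume "eventually P F"
      then show "eventually P G"
        unfolding evG by (intro exI[of _ P] exI[of _ "\<lambda>_. True"]) auto
    qed
    show "filter_mult f G G \<le> G"
    proof (rule filter_leI)
      fix R assume "eventually R G"
      then obtain B A where BA: "eventually B F" "eventually A q" "\<And>x. B x \<Longrightarrow> E A x \<Longrightarrow> R x"
        unfolding evG by blast
      have "eventually (\<lambda>c. eventually (\<lambda>a. B (f c a)) F) F"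
        using filter_leD[OF F(3) BA(1)] by (simp add: eventually_filter_mult)
      \<comment> \<open>The witnesses are the translates of \<open>B\<close> and \<open>A\<close> by
        \<open>c\<close>: \<open>E A c\<close> puts the translate of \<open>A\<close> into
        \<open>q\<close>, and associativity turns \<open>E\<close> of it at \<open>a\<close> into
        \<open>E A (f c a)\<close>.\<close>
      moreover have "eventually (\<lambda>a. R (f c a)) G"
        if "eventually (\<lambda>a. B (f c a)) F" "E A c" for c
        unfolding evG using that BA(3)
        by (intro exI[of _ "\<lambda>a. B (f c a)"] exI[of _ "\<lambda>a. A (f c a)"]) (auto simp: E_def assoc)
      ultimately have "eventually (\<lambda>c. eventually (\<lambda>a. R (f c a)) G) G"
        unfolding evG[of "\<lambda>c. eventually (\<lambda>a. R (f c a)) G"] using BA(2) by blast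
      then show "eventually R (filter_mult f G G)" by (simp add: eventually_filter_mult)
    qed
  qed
  have "F \<le> q"
  proof (rule filter_leI)
    fix A assume "eventually A q"
    then have "eventually (E A) G" unfolding evG
      by (intro exI[of _ "\<lambda>_. True"] exI[of _ A]) auto
    then have "eventually A (filter_mult f F q)"
      unfolding \<open>G = F\<close> eventually_filter_mult E_def .
    then show "eventually A F" unfolding Fq .
  qed
  with q(2) have "F = q" by simp
  with q(1) F that show ?thesis by blast
qed

section \<open>A strategic Milliken--Taylor theorem\<close>

text \<open>Ultrafilters below this filter live on the finite sets of naturals beyond any given bound,
  and every member of such an ultrafilter contains, for some \<open>m\<close> and all \<open>j\<close>, a superset
  of \<open>{m..<j}\<close>. The latter sets form a closed ideal of the semigroup of ultrafilters.\<close>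

definition interval_filter :: "nat set filter" where
  "interval_filter = Abs_filter (\<lambda>P. \<exists>m0 j. \<forall>m\<ge>m0. \<forall>a.
     finite a \<longrightarrow> a \<subseteq> {m0..} \<longrightarrow> {m..<j m} \<subseteq> a \<longrightarrow> P a)"

lemma eventually_interval_filter:
  "eventually P interval_filter \<longleftrightarrow>
     (\<exists>m0 j. \<forall>m\<ge>m0. \<forall>a. finite a \<longrightarrow> a \<subseteq> {m0..} \<longrightarrow> {m..<j m} \<subseteq> a \<longrightarrow> P a)"
  unfolding interval_filter_def
proof (rule eventually_Abs_filter, unfold_locales, goal_cases)
  case 1
  then show ?case by simp
next
  case (2 P Q)
  from 2(1) obtain m0 j0 where
    P: "\<forall>m\<ge>m0. \<forall>a. finite a \<longrightarrow> a \<subseteq> {m0..} \<longrightarrow> {m..<j0 m} \<subseteq> a \<longrightarrow> P a" by (elim exE)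
  from 2(2) obtain m1 j1 where
    Q: "\<forall>m\<ge>m1. \<forall>a. finite a \<longrightarrow> a \<subseteq> {m1..} \<longrightarrow> {m..<j1 m} \<subseteq> a \<longrightarrow> Q a" by (elim exE)
  show ?case
  proof (intro exI[of _ "max m0 m1"] exI[of _ "\<lambda>m. max (j0 m) (j1 m)"] allI impI)
    fix m :: nat and a :: "nat set"
    assume *: "m \<ge> max m0 m1" "finite a" "a \<subseteq> {max m0 m1..}" "{m..<max (j0 m) (j1 m)} \<subseteq> a"
    then have "a \<subseteq> {m0..}" "a \<subseteq> {m1..}" "{m..<j0 m} \<subseteq> a" "{m..<j1 m} \<subseteq> a"
      by (auto simp: subset_iff)
    with * P[rule_format, of m a] Q[rule_format, of m a] show "P a \<and> Q a" by simp
  qed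
next
  case (3 P Q)
  from 3(2) obtain m0 j where
    "\<forall>m\<ge>m0. \<forall>a. finite a \<longrightarrow> a \<subseteq> {m0..} \<longrightarrow> {m..<j m} \<subseteq> a \<longrightarrow> P a" by (elim exE)
  with 3(1) show ?case
    by (intro exI[of _ m0] exI[of _ j]) simp
qed

lemma interval_filter_ne_bot: "interval_filter \<noteq> bot"
proof
  assume "interval_filter = bot"
  then have "eventually (\<lambda>_. False) interval_filter" by simp
  then obtain m0 j where
    *: "\<forall>m\<ge>m0. \<forall>a :: nat set. finite a \<longrightarrow> a \<subseteq> {m0..} \<longrightarrow> {m..<j m} \<subseteq> a \<longrightarrow> False"
    unfolding eventually_interval_filter by (elim exE)
  have "{m0..<j m0} \<subseteq> {m0..}" by auto
  with *[rule_format, of m0 "{m0..<j m0}"] show False by simp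
qed

text \<open>The same \<open>m0\<close> and \<open>j\<close> serve for the product, since
  \<open>a \<union> b\<close> inherits the interval \<open>{m..<j m}\<close> from
  \<open>a\<close>.\<close>

lemma interval_filter_idempotent:
  "filter_mult (\<union>) interval_filter interval_filter \<le> interval_filter"
proof (rule filter_leI)
  fix P assume "eventually P interval_filter"
  then obtain m0 j where
    P: "\<forall>m\<ge>m0. \<forall>a. finite a \<longrightarrow> a \<subseteq> {m0..} \<longrightarrow> {m..<j m} \<subseteq> a \<longrightarrow> P a"
    unfolding eventually_interval_filter by (elim exE)
  have ev: "eventually (\<lambda>b. P (a \<union> b)) interval_filter"
    if "m \<ge> m0" "finite a" "a \<subseteq> {m0..}" "{m..<j m} \<subseteq> a" for m a
    unfolding eventually_interval_filter
    by (intro exI[of _ m0] exI[of _ j] allI impI P[rule_format, OF that(1)]) (use that in auto)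
  show "eventually P (filter_mult (\<union>) interval_filter interval_filter)"
    unfolding eventually_filter_mult
    by (rule eventually_interval_filter[THEN iffD2], intro exI[of _ m0] exI[of _ j] allI impI)
      (rule ev)
qed

lemma eventually_interval_filter_finite: "eventually finite interval_filter"
  by (auto simp: eventually_interval_filter)

lemma eventually_interval_filter_nonempty: "eventually (\<lambda>a. a \<noteq> {}) interval_filter"
  unfolding eventually_interval_filter by (intro exI[of _ 0] exI[of _ Suc]) auto

lemma eventually_interval_filter_beyond:
  assumes "finite a"
  shows "eventually (\<lambda>b. \<forall>x\<in>a. \<forall>y\<in>b. x < y) interval_filter"
proof -
  obtain n where "\<forall>x\<in>a. x < n" using assms finite_nat_set_iff_bounded by blast
  then have "\<forall>x\<in>a. \<forall>y\<in>b. x < y" if "b \<subseteq> {n..}" for b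
    using that by (meson atLeast_iff less_le_trans subsetD)
  then show ?thesis
    unfolding eventually_interval_filter by (intro exI[of _ n] exI allI impI)
qed

text \<open>If for each \<open>m\<close> some \<open>{m..<j m}\<close> were contained in no element
  of \<open>P\<close>, the complement of \<open>P\<close> would contain a basic set of
  \<open>interval_filter\<close> and so belong to \<open>p\<close>.\<close>

lemma interval_filter_positive:
  assumes "ultra_filter p" "p \<le> interval_filter" "eventually P p"
  obtains m where "\<And>j. \<exists>a. P a \<and> {m..<j} \<subseteq> a"
proof (rule ccontr)
  assume "\<not> thesis"
  with that have "\<forall>m. \<exists>j. \<forall>a. {m..<j} \<subseteq> a \<longrightarrow> \<not> P a" by blast
  then obtain j where "\<forall>m a. {m..<j m} \<subseteq> a \<longrightarrow> \<not> P a" by metis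
  then have "eventually (\<lambda>a. \<not> P a) interval_filter"
    unfolding eventually_interval_filter by (intro exI[of _ 0] exI[of _ j]) simp
  then have "eventually (\<lambda>a. \<not> P a) p" by (rule filter_leD[OF assms(2)])
  with assms show False by (simp add: ultra_filter_not)
qed

section \<open>Positions, admissible blocks and monochromatic block sequences\<close>

text \<open>A position of the construction is the list of the blocks chosen so far, most recent
  block first.\<close>

fun past_unions :: "nat set list \<Rightarrow> nat set set" where
  "past_unions [] = {{}}"
| "past_unions (a # s) = past_unions s \<union> (\<lambda>c. c \<union> a) ` past_unions s"

text \<open>These are the shrinking sets of the Galvin--Glazer argument. Requiring
  \<open>a \<union> b\<close> to be admissible one step earlier keeps unions of later blocks
  admissible; the clause on \<open>R\<close> runs over all past unions whose last block is
  \<open>a\<close>.\<close>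

fun next_blocks :: "nat set set \<Rightarrow> (nat set \<Rightarrow> nat set \<Rightarrow> bool) \<Rightarrow> nat set list \<Rightarrow> nat set set" where
  "next_blocks A R [] = A"
| "next_blocks A R (a # s) = {b \<in> next_blocks A R s. a \<union> b \<in> next_blocks A R s \<and>
     (\<forall>c\<in>past_unions s. R (c \<union> a) b) \<and> (\<forall>x\<in>a. \<forall>y\<in>b. x < y)}"

abbreviation history :: "(nat \<Rightarrow> 'b) \<Rightarrow> nat \<Rightarrow> 'b list" where
  "history a n \<equiv> rev (map a [0..<n])"

lemma finite_past_unions: "finite (past_unions s)"
  by (induction s) auto

lemma past_union_Un_next_block:
  "c \<in> past_unions s \<Longrightarrow> b \<in> next_blocks A R s \<Longrightarrow> c \<union> b \<in> A"
proof (induction s arbitrary: b c)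
  case (Cons a s)
  then show ?case by (auto simp: Un_assoc)
qed simp

lemma past_unions_history:
  assumes "H \<subseteq> {..<n}"
  shows "\<Union> (a ` H) \<in> past_unions (history a n)"
  using assms
proof (induction n arbitrary: H)
  case (Suc n)
  have *: "\<Union> (a ` (H - {n})) \<in> past_unions (history a n)"
    using Suc.prems by (intro Suc.IH) auto
  show ?case
  proof (cases "n \<in> H")
    case True
    then have "\<Union> (a ` H) = \<Union> (a ` (H - {n})) \<union> a n" by auto
    then show ?thesis using * by simp
  next
    case False
    then show ?thesis using * by simp
  qed
qed simp

lemma next_blocks_history_antimono:
  assumes "m \<le> n"
  shows "next_blocks A R (history a n) \<subseteq> next_blocks A R (history a m)"
  using assms by (induction n rule: dec_induct) auto

text \<open>Blocks are joined from the largest index down: the union of the later blocks is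
  admissible after \<open>a n\<close>, hence its union with \<open>a n\<close> is admissible before
  \<open>a n\<close>.\<close>

lemma Union_next_blocks_history:
  assumes "\<And>n. a n \<in> next_blocks A R (history a n)" "finite K" "K \<noteq> {}" "K \<subseteq> {k..}"
  shows "\<Union> (a ` K) \<in> next_blocks A R (history a k)"
  using assms(2-)
proof (induction K arbitrary: k rule: finite_linorder_min_induct)
  case (insert n K)
  have "\<Union> (a ` insert n K) \<in> next_blocks A R (history a n)"
  proof (cases "K = {}")
    case True
    then show ?thesis using assms(1) by simp
  next
    case False
    then have "\<Union> (a ` K) \<in> next_blocks A R (history a (Suc n))"
      using insert.hyps by (intro insert.IH) auto
    then show ?thesis by simp
  qed
  then show ?case using insert.prems next_blocks_history_antimono[of k n] by auto
qed simp

text \<open>The Milliken--Taylor theorem in the form of a strategy: \<open>ok\<close> are the legal positions, and the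
  freedom to swallow long intervals leaves room for a selection principle.\<close>

lemma Milliken_Taylor_positions:
  fixes col :: "nat set \<Rightarrow> nat set \<Rightarrow> nat"
  assumes "\<And>a b. col a b \<le> k"
  obtains i and ok :: "nat set list \<Rightarrow> bool" where
    "ok []"
    "\<And>s. ok s \<Longrightarrow> \<exists>m. \<forall>j. \<exists>a. ok (a # s) \<and> {m..<j} \<subseteq> a"
    "\<And>a n. (\<And>n. ok (history a n)) \<Longrightarrow> finite (a n) \<and> a n \<noteq> {}"
    "\<And>a. (\<And>n. ok (history a n)) \<Longrightarrow> disjoint_family a"
    "\<And>a H K. (\<And>n. ok (history a n)) \<Longrightarrow> H \<in> Fin UNIV \<Longrightarrow> K \<in> Fin UNIV \<Longrightarrow>
       block_less H K \<Longrightarrow> col (\<Union> (a ` H)) (\<Union> (a ` K)) = i"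
proof -
  obtain p :: "nat set filter" where p: "ultra_filter p" "p \<le> interval_filter"
    "filter_mult (\<union>) p p \<le> p"
    by (rule idempotent_ultra_filter[of "(\<union>)", OF _ interval_filter_ne_bot interval_filter_idempotent])
      (simp add: Un_assoc)
  have "\<exists>i. eventually (\<lambda>b. col a b = i) p" for a
    by (rule ultra_filter_finite_coloring[OF p(1), of "{..k}" "col a"]) (auto simp: assms)
  then obtain c where c: "\<And>a. eventually (\<lambda>b. col a b = c a) p" by metis
  have ck: "c a \<le> k" for a
  proof -
    have "eventually (\<lambda>b. c a \<le> k) p" using c[of a] by eventually_elim (metis assms)
    then show ?thesis using p(1) by (auto simp: ultra_filter_def)
  qed
  obtain i where i: "eventually (\<lambda>a. c a = i) p"
    by (rule ultra_filter_finite_coloring[OF p(1), of "{..k}" c]) (auto simp: ck)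
  define A where "A = {a. finite a \<and> a \<noteq> {} \<and> c a = i}"
  define N where "N = next_blocks A (\<lambda>a b. col a b = i)"
  \<comment> \<open>For \<open>a\<close> in \<open>star s\<close> the translate of
    \<open>N s\<close> by \<open>a\<close> is in \<open>p\<close>, which keeps the next set of
    admissible blocks in \<open>p\<close>.\<close>
  define star where "star s = {a \<in> N s. eventually (\<lambda>b. a \<union> b \<in> N s) p}" for s
  define ok where "ok s \<longleftrightarrow> (\<forall>t a u. s = t @ a # u \<longrightarrow> a \<in> star u)" for s
  have ok_Cons: "ok (a # s) \<longleftrightarrow> ok s \<and> a \<in> star s" for a s
    unfolding ok_def by (auto simp: Cons_eq_append_conv)
  have A: "eventually (\<lambda>a. a \<in> A) p"
    unfolding A_def mem_Collect_eq
    by (intro eventually_conj i filter_leD[OF p(2)] eventually_interval_filter_finite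
        eventually_interval_filter_nonempty)
  have NA: "N s \<subseteq> A" for s unfolding N_def by (induction s) auto
  have N: "eventually (\<lambda>a. a \<in> N s) p" if "ok s" for s
    using that
  proof (induction s)
    case Nil
    then show ?case using A by (simp add: N_def)
  next
    case (Cons a s)
    then have a: "a \<in> star s" and s: "eventually (\<lambda>a. a \<in> N s) p" by (auto simp: ok_Cons)
    have "c (d \<union> a) = i" if "d \<in> past_unions s" for d
      using past_union_Un_next_block[OF that] a by (auto simp: star_def N_def A_def)
    then have "eventually (\<lambda>b. \<forall>d\<in>past_unions s. col (d \<union> a) b = i) p"
      using c by (intro eventually_ball_finite finite_past_unions) metis
    moreover have "finite a" using a NA by (auto simp: star_def A_def)
    then have "eventually (\<lambda>b. \<forall>x\<in>a. \<forall>y\<in>b. x < y) p"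
      by (intro filter_leD[OF p(2)] eventually_interval_filter_beyond)
    moreover have "eventually (\<lambda>b. a \<union> b \<in> N s) p" using a by (simp add: star_def)
    ultimately show ?case using s by (simp add: N_def eventually_conj_iff)
  qed
  \<comment> \<open>Idempotence enters here: \<open>N s\<close> is in \<open>p\<close>, hence in the
    product of \<open>p\<close> with itself, so almost every \<open>a\<close> has a translate in
    \<open>p\<close>.\<close>
  have star: "eventually (\<lambda>a. a \<in> star s) p" if "ok s" for s
    using N[OF that] filter_leD[OF p(3) N[OF that]]
    by (simp add: star_def eventually_conj_iff eventually_filter_mult)
  show thesis
  proof (rule that[of ok i])
    show "ok []" by (simp add: ok_def)
    show "\<exists>m. \<forall>j. \<exists>a. ok (a # s) \<and> {m..<j} \<subseteq> a" if "ok s" for s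
      by (rule interval_filter_positive[OF p(1,2) star[OF that]]) (use that in \<open>auto simp: ok_Cons\<close>)
  next
    fix a assume ok: "\<And>n. ok (history a n)"
    have aN: "a n \<in> N (history a n)" for n
      using ok[of "Suc n"] by (simp add: ok_Cons star_def)
    show "finite (a n) \<and> a n \<noteq> {}" for n
      using aN[of n] NA by (auto simp: A_def)
    have "a m \<inter> a n = {}" if "m < n" for m n
    proof -
      have "a n \<in> N (history a (Suc m))"
        using aN[of n] next_blocks_history_antimono[OF Suc_leI[OF that]] unfolding N_def by blast
      then show ?thesis by (fastforce simp: N_def)
    qed
    then show "disjoint_family a"
      unfolding disjoint_family_on_def by (metis Int_commute nat_neq_iff)
    fix H K :: "nat set"
    assume HK: "H \<in> Fin UNIV" "K \<in> Fin UNIV" "block_less H K"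
    \<comment> \<open>Splitting off the last index of \<open>H\<close> writes its union as a past
      union joined with \<open>a n\<close>, as in the color condition of \<open>next_blocks\<close>;
      \<open>K\<close> starts at \<open>Suc n\<close> or later.\<close>
    define n where "n = Max H"
    have H: "finite H" "H \<noteq> {}" and K: "finite K" "K \<noteq> {}" using HK by (auto simp: Fin_def)
    have "\<Union> (a ` (H - {n})) \<in> past_unions (history a n)"
      using H by (intro past_unions_history) (auto simp: n_def order.strict_iff_order)
    moreover have "\<Union> (a ` K) \<in> N (history a (Suc n))"
      unfolding N_def using aN K HK(3)
      by (intro Union_next_blocks_history) (auto simp: N_def n_def block_less_def Suc_le_eq)
    moreover have "\<Union> (a ` H) = \<Union> (a ` (H - {n})) \<union> a n"
      using Max_in[OF H] unfolding n_def by auto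
    ultimately show "col (\<Union> (a ` H)) (\<Union> (a ` K)) = i"
      by (simp add: N_def)
  qed
qed

section \<open>Bounds on intervals along a single increasing sequence\<close>

text \<open>For fixed \<open>d\<close> there are only finitely many positions reachable with bounds of at most
  \<open>d\<close>, so that a common starting point \<open>M d\<close> of the available intervals exists.\<close>

lemma uniform_play:
  fixes ok :: "nat set list \<Rightarrow> bool"
  assumes "ok []" and step: "\<And>s. ok s \<Longrightarrow> \<exists>m. \<forall>j. \<exists>a. ok (a # s) \<and> {m..<j} \<subseteq> a"
  obtains M :: "nat \<Rightarrow> nat" where "mono M"
    "\<And>d :: nat \<Rightarrow> nat. strict_mono d \<Longrightarrow>
       \<exists>a. (\<forall>n. ok (history a n)) \<and> (\<forall>n. {M (d n)..<d (Suc n)} \<subseteq> a n)"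
proof -
  obtain m nxt where nxt: "\<And>s j. ok s \<Longrightarrow> ok (nxt s j # s)"
      "\<And>s j. ok s \<Longrightarrow> {m s..<j} \<subseteq> nxt s j"
    using step by metis
  \<comment> \<open>With the answers \<open>nxt\<close> fixed, the list of bounds played so far
    determines the position.\<close>
  define pos where "pos = foldl (\<lambda>s j. nxt s j # s) []"
  have pos_snoc: "pos (js @ [j]) = nxt (pos js) j # pos js" for js j
    by (simp add: pos_def)
  have ok_pos: "ok (pos js)" for js
    by (induction js rule: rev_induct) (simp_all add: pos_snoc nxt(1), simp add: pos_def assms(1))
  define J where "J d = {js. set js \<subseteq> {..d} \<and> length js \<le> d}" for d :: nat
  have J: "finite (J d)" "[] \<in> J d" for d
    unfolding J_def by (auto intro: finite_lists_length_le)
  define M where "M d = Max ((\<lambda>js. m (pos js)) ` J d)" for d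
  show thesis
  proof (rule that[of M])
    show "mono M"
      unfolding mono_def M_def
    proof (intro allI impI Max_mono image_mono)
      fix d e :: nat assume "d \<le> e"
      then show "J d \<subseteq> J e" unfolding J_def by (auto intro: order_trans)
    qed (use J in auto)
  next
    fix d :: "nat \<Rightarrow> nat" assume d: "strict_mono d"
    \<comment> \<open>The bounds played before step \<open>n\<close> are \<open>d 1\<close> to
      \<open>d n\<close>, so all are at most \<open>d n\<close>, and so is their number
      \<open>n\<close>. Hence this list lies in \<open>J (d n)\<close>.\<close>
    define js where "js n = map (\<lambda>i. d (Suc i)) [0..<n]" for n
    define a where "a n = nxt (pos (js n)) (d (Suc n))" for n
    have "pos (js n) = history a n" for n
      by (induction n) (simp_all add: js_def a_def pos_snoc, simp add: pos_def)
    then have "ok (history a n)" for n by (metis ok_pos)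
    moreover have "{M (d n)..<d (Suc n)} \<subseteq> a n" for n
    proof -
      have "d (Suc i) \<le> d n" if "i < n" for i
        using d that by (simp add: strict_mono_less_eq)
      then have "js n \<in> J (d n)"
        using strict_mono_imp_increasing[OF d, of n] by (auto simp: J_def js_def)
      then have "m (pos (js n)) \<le> M (d n)"
        unfolding M_def using J by (intro Max_ge) auto
      then show ?thesis
        using nxt(2)[OF ok_pos, of "js n" "d (Suc n)"] unfolding a_def by (auto simp: subset_iff)
    qed
    ultimately show "\<exists>a. (\<forall>n. ok (history a n)) \<and> (\<forall>n. {M (d n)..<d (Suc n)} \<subseteq> a n)"
      by blast
  qed
qed

lemma strict_mono_interval:
  fixes d :: "nat \<Rightarrow> nat"
  assumes "strict_mono d" "d 0 \<le> c"
  obtains n where "d n \<le> c" "c < d (Suc n)"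
proof -
  have "c < d (Suc c)" using strict_mono_imp_increasing[OF assms(1), of "Suc c"] by simp
  then have ex: "\<exists>n. c < d n" by blast
  define n where "n = (LEAST n. c < d n)"
  have n: "c < d n" unfolding n_def using ex by (rule LeastI_ex)
  then obtain n' where n': "n = Suc n'" using assms(2) by (cases n) auto
  then have "\<not> c < d n'" using not_less_Least[of n' "\<lambda>n. c < d n"] by (simp add: n_def)
  with n n' that[of n'] show thesis by simp
qed

text \<open>Starting from the cover \<open>\<A> d\<close> of all \<open>U i \<inter> U i'\<close> with \<open>M d \<le> i < e\<close> and
  \<open>M e \<le> i'\<close>, iterating a bound for the finite selections yields consecutive intervals: if a
  selected set has \<open>e \<le> d (Suc n)\<close>, then \<open>i\<close> lies in the \<open>n\<close>-th of them, and otherwise \<open>i'\<close>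
  lies in the next one.\<close>

lemma consecutive_intervals:
  fixes M :: "nat \<Rightarrow> nat" and U :: "nat \<Rightarrow> 'a set"
  assumes "mono M" and fin: "\<And>d. finite (F d)"
    and F: "\<And>d W. W \<in> F d \<Longrightarrow> \<exists>i e i'. W = U i \<inter> U i' \<and> M d \<le> i \<and> i < e \<and> M e \<le> i'"
  obtains d :: "nat \<Rightarrow> nat" where "strict_mono d"
    "\<And>c W. W \<in> F c \<Longrightarrow> \<exists>n i. c < d (Suc n) \<and> M (d n) \<le> i \<and> i < d (Suc n) \<and> W \<subseteq> U i"
proof -
  have "\<forall>x. \<exists>y. snd x \<in> F (fst x) \<longrightarrow>
      snd x = U (fst y) \<inter> U (snd (snd y)) \<and> M (fst x) \<le> fst y \<and>
      fst y < fst (snd y) \<and> M (fst (snd y)) \<le> snd (snd y)"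
  proof
    fix x
    show "\<exists>y. snd x \<in> F (fst x) \<longrightarrow>
        snd x = U (fst y) \<inter> U (snd (snd y)) \<and> M (fst x) \<le> fst y \<and>
        fst y < fst (snd y) \<and> M (fst (snd y)) \<le> snd (snd y)"
    proof (cases "snd x \<in> F (fst x)")
      case True
      from F[OF True] show ?thesis by auto
    qed auto
  qed
  from choice[OF this] obtain h where h: "\<forall>x. snd x \<in> F (fst x) \<longrightarrow>
      snd x = U (fst (h x)) \<inter> U (snd (snd (h x))) \<and> M (fst x) \<le> fst (h x) \<and>
      fst (h x) < fst (snd (h x)) \<and> M (fst (snd (h x))) \<le> snd (snd (h x))" ..
  define p q r where "p d W = fst (h (d, W))" and "q d W = fst (snd (h (d, W)))"
    and "r d W = snd (snd (h (d, W)))" for d W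
  have pqr: "W = U (p d W) \<inter> U (r d W) \<and> M d \<le> p d W \<and> p d W < q d W \<and> M (q d W) \<le> r d W"
    if "W \<in> F d" for d W
    using h[rule_format, of "(d, W)"] that by (simp add: p_def q_def r_def)
  \<comment> \<open>\<open>g c\<close> exceeds \<open>c\<close> and every \<open>r d W\<close> with
    \<open>d \<le> c\<close>, so a selection with index below \<open>d (Suc n)\<close> has its
    second index \<open>i'\<close> below \<open>d (Suc (Suc n))\<close>.\<close>
  define g where "g c = Suc (c + (\<Sum>d\<le>c. \<Sum>W\<in>F d. Suc (r d W)))" for c
  have g: "r d W < g c" if "W \<in> F d" "d \<le> c" for d W c
  proof -
    have "Suc (r d W) \<le> (\<Sum>W\<in>F d. Suc (r d W))"
      using that fin by (intro member_le_sum) auto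
    also have "\<dots> \<le> (\<Sum>d\<le>c. \<Sum>W\<in>F d. Suc (r d W))"
      using that by (intro member_le_sum) auto
    finally show ?thesis by (simp add: g_def)
  qed
  define d where "d n = (g ^^ n) 0" for n
  have d_Suc: "d (Suc n) = g (d n)" for n by (simp add: d_def)
  have d: "strict_mono d" by (rule strict_mono_Suc_iff[THEN iffD2]) (simp add: d_Suc g_def)
  show thesis
  proof (rule that[OF d])
    fix c W assume W: "W \<in> F c"
    obtain n where c: "d n \<le> c" "c < d (Suc n)"
      by (rule strict_mono_interval[OF d, of c]) (simp add: d_def)
    note * = pqr[OF W]
    show "\<exists>n i. c < d (Suc n) \<and> M (d n) \<le> i \<and> i < d (Suc n) \<and> W \<subseteq> U i"
    proof (cases "q c W \<le> d (Suc n)")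
      case True
      with * monoD[OF \<open>mono M\<close> c(1)] have "M (d n) \<le> p c W \<and> p c W < d (Suc n) \<and> W \<subseteq> U (p c W)"
        by auto
      with c(2) show ?thesis by blast
    next
      case False
      have "r c W < d (Suc (Suc n))" unfolding d_Suc[of "Suc n"] using g[OF W] c by simp
      moreover have "M (d (Suc n)) \<le> M (q c W)" using False by (intro monoD[OF \<open>mono M\<close>]) simp
      ultimately have "M (d (Suc n)) \<le> r c W \<and> r c W < d (Suc (Suc n)) \<and> W \<subseteq> U (r c W)"
        using * by auto
      moreover have "c < d (Suc (Suc n))"
        using c(2) d by (metis lessI less_trans strict_mono_less)
      ultimately show ?thesis by blast
    qed
  qed
qed

section \<open>Selections from \<open>\<omega>\<close>-covers\<close>

text \<open>The balls of radius \<open>1 / Suc n\<close> around the points of a countable dense set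
  form a base.\<close>

lemma metrizable_separable_imp_second_countable:
  assumes "metrizable_space X" "separable_space X"
  shows "second_countable X"
proof -
  obtain T d where T: "Metric_space T d" and X: "X = Metric_space.mtopology T d"
    using assms(1) by (auto simp: metrizable_space_def)
  interpret Metric_space T d by (rule T)
  obtain C where C: "countable C" "C \<subseteq> T" "mtopology closure_of C = T"
    using assms(2) by (auto simp: separable_space_def X)
  define B where "B = (\<lambda>(c, n). mball c (1 / Suc n)) ` (C \<times> (UNIV :: nat set))"
  have "countable B" unfolding B_def using C(1) by simp
  moreover have "openin X V" if "V \<in> B" for V
    using that by (auto simp: B_def X)
  moreover have "\<exists>V\<in>B. x \<in> V \<and> V \<subseteq> U" if U: "openin X U" and "x \<in> U" for U x
  proof -
    have x: "x \<in> T" using openin_subset[OF U] that(2) by (auto simp: X)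
    have "\<exists>r>0. mball x r \<subseteq> U" using that by (simp add: X openin_mtopology)
    then obtain r where r: "r > 0" "mball x r \<subseteq> U" by (elim exE conjE)
    obtain n :: nat where n: "1 / Suc n < r / 2"
      by (rule nat_approx_posE[OF half_gt_zero[OF r(1)]])
    have "x \<in> mtopology closure_of C" using C(3) x by simp
    then have "\<exists>c\<in>C. c \<in> mball x (1 / Suc n)"
      by (simp add: metric_closure_of del: in_mball)
    then obtain c where c: "c \<in> C" "d x c < 1 / Suc n" by auto
    have "mball c (1 / Suc n) \<subseteq> mball x r"
    proof
      fix y assume "y \<in> mball c (1 / Suc n)"
      then have y: "y \<in> T" "c \<in> T" "d c y < 1 / Suc n" by auto
      have "d x y \<le> d x c + d c y" using x y by (intro triangle)
      also have "\<dots> < r" using c(2) y(3) n by linarith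
      finally show "y \<in> mball x r" using x y by simp
    qed
    moreover have "x \<in> mball c (1 / Suc n)" using c C(2) x by (auto simp: commute)
    ultimately show ?thesis using r(2) c(1) unfolding B_def by blast
  qed
  ultimately show ?thesis unfolding second_countable_def by blast
qed

text \<open>One member is chosen for each finite part \<open>g\<close> of a countable base whose
  union fits into a member. For a finite \<open>S\<close> inside a member, basic sets around its
  points form such a \<open>g\<close>.\<close>

lemma countable_omega_subcover:
  assumes "second_countable X" "\<U> \<in> open_omega_covers X"
  obtains \<V> where "countable \<V>" "\<V> \<subseteq> \<U>" "\<V> \<in> open_omega_covers X"
proof -
  obtain B where B: "countable B"
      "\<forall>U x. openin X U \<and> x \<in> U \<longrightarrow> (\<exists>V\<in>B. x \<in> V \<and> V \<subseteq> U)"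
    using assms(1) unfolding second_countable_def by (elim exE conjE)
  have cov: "\<forall>U\<in>\<U>. U \<noteq> {} \<and> U \<subset> topspace X" and op: "\<forall>U\<in>\<U>. openin X U"
    and omega: "\<forall>S. finite S \<and> S \<subseteq> topspace X \<longrightarrow> (\<exists>U\<in>\<U>. S \<subseteq> U)"
    using assms(2) by (simp_all add: open_omega_covers_def is_cover_def)
  define G where "G = {g. finite g \<and> g \<subseteq> B \<and> (\<exists>U\<in>\<U>. \<Union>g \<subseteq> U)}"
  have "\<forall>g\<in>G. \<exists>U. U \<in> \<U> \<and> \<Union>g \<subseteq> U" by (simp add: G_def Bex_def)
  then obtain u where u: "\<forall>g\<in>G. u g \<in> \<U> \<and> \<Union>g \<subseteq> u g"
    unfolding bchoice_iff by (elim exE)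
  have "countable G"
    by (rule countable_subset[OF _ countable_Collect_finite_subset[OF B(1)]]) (auto simp: G_def)
  then have "countable (u ` G)" by simp
  moreover have sub: "u ` G \<subseteq> \<U>" using u by auto
  moreover have "u ` G \<in> open_omega_covers X"
  proof -
    have *: "\<exists>V\<in>u ` G. S \<subseteq> V" if "finite S" "S \<subseteq> topspace X" for S
    proof -
      obtain U where U: "U \<in> \<U>" "S \<subseteq> U" using omega \<open>finite S\<close> \<open>S \<subseteq> topspace X\<close> by blast
      have "openin X U" using op U(1) by blast
      have "\<exists>V. V \<in> B \<and> x \<in> V \<and> V \<subseteq> U" if "x \<in> S" for x
        using B(2)[rule_format, of U x] \<open>openin X U\<close> U(2) that by blast
      then have "\<forall>x\<in>S. \<exists>V. V \<in> B \<and> x \<in> V \<and> V \<subseteq> U" ..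
      then obtain b where b: "\<forall>x\<in>S. b x \<in> B \<and> x \<in> b x \<and> b x \<subseteq> U"
        unfolding bchoice_iff by (elim exE)
      then have "b ` S \<in> G" using U(1) that(1) by (auto simp: G_def)
      moreover have "S \<subseteq> \<Union> (b ` S)" using b by auto
      ultimately show ?thesis using u by blast
    qed
    have "topspace X \<subseteq> \<Union> (u ` G)"
      using *[of "{x}" for x] by auto
    moreover have "\<Union> (u ` G) \<subseteq> topspace X" using sub cov by blast
    ultimately have "\<Union> (u ` G) = topspace X" by blast
    with * sub cov op show ?thesis
      by (simp add: open_omega_covers_def is_cover_def subset_iff)
  qed
  ultimately show thesis by (rule that)
qed

text \<open>For each of the first \<open>m\<close> sets a point missed by it is added to
  \<open>S\<close>; a member containing the enlarged set must have index at least
  \<open>m\<close>.\<close>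

lemma omega_cover_tail:
  fixes U :: "nat \<Rightarrow> 'a set"
  assumes "range U \<in> open_omega_covers X" "finite S" "S \<subseteq> topspace X"
  shows "\<exists>i\<ge>m. S \<subseteq> U i"
proof -
  have U: "U i \<subset> topspace X" for i
    using assms(1) by (auto simp: open_omega_covers_def is_cover_def)
  have om: "\<forall>T. finite T \<and> T \<subseteq> topspace X \<longrightarrow> (\<exists>V\<in>range U. T \<subseteq> V)"
    using assms(1) by (simp add: open_omega_covers_def)
  have "\<forall>i. \<exists>y. y \<in> topspace X \<and> y \<notin> U i" using U by blast
  from choice[OF this] obtain y where y: "\<forall>i. y i \<in> topspace X \<and> y i \<notin> U i" by (elim exE)
  obtain V where "V \<in> range U" "S \<union> y ` {..<m} \<subseteq> V"
    using om[rule_format, of "S \<union> y ` {..<m}"] y assms(2,3) by blast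
  then obtain i where "S \<union> y ` {..<m} \<subseteq> U i" by blast
  then have "S \<subseteq> U i" "\<not> i < m" using y by auto
  then show ?thesis by (intro exI[of _ i]) simp
qed

text \<open>The selections from the covers \<open>\<A> c\<close> determine the bounds
  \<open>d\<close> of a play in which every selected set lies in some \<open>U i\<close> with
  \<open>i\<close> in a block. For \<open>\<omega>\<close>-covers this suffices; for large covers
  the members at a point are counted.\<close>

lemma selective_play:
  fixes U :: "nat \<Rightarrow> 'a set" and ok :: "nat set list \<Rightarrow> bool"
  assumes \<B>: "\<B> \<in> {open_large_covers X, open_omega_covers X}"
    and S_fin: "S_fin (open_omega_covers X) \<B>"
    and U: "range U \<in> open_omega_covers X" "inj U"
    and ok: "ok []" "\<And>s. ok s \<Longrightarrow> \<exists>m. \<forall>j. \<exists>a. ok (a # s) \<and> {m..<j} \<subseteq> a"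
    and disj: "\<And>a. (\<And>n. ok (history a n)) \<Longrightarrow> disjoint_family a"
  obtains a where "\<And>n. ok (history a n)" "(\<Union>n. U ` a n) \<in> \<B>"
proof -
  obtain M :: "nat \<Rightarrow> nat" where M: "mono M" and play:
    "\<And>d. strict_mono d \<Longrightarrow>
       \<exists>a. (\<forall>n. ok (history a n)) \<and> (\<forall>n. {M (d n)..<d (Suc n)} \<subseteq> a n)"
  proof (rule uniform_play[of ok, OF ok], goal_cases)
    case (2 M)
    from 2(2-) show ?case by (rule 2(1))
  qed
  have U_props: "U i \<noteq> {}" "U i \<subset> topspace X" "openin X (U i)" for i
    using U(1) by (auto simp: open_omega_covers_def is_cover_def)
  define \<A> where "\<A> c = {W. W \<noteq> {} \<and>
    (\<exists>i e i'. W = U i \<inter> U i' \<and> M c \<le> i \<and> i < e \<and> M e \<le> i')}" for c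
  have "\<A> c \<in> open_omega_covers X" for c
  proof -
    \<comment> \<open>Adding \<open>x0\<close> to \<open>S\<close> keeps the intersection of the two
      chosen sets nonempty even for empty \<open>S\<close>.\<close>
    obtain x0 where x0: "x0 \<in> topspace X" using U_props[of 0] by blast
    have omega: "\<exists>W\<in>\<A> c. S \<subseteq> W" if S: "finite S" "S \<subseteq> topspace X" for S
    proof -
      have S': "finite (insert x0 S)" "insert x0 S \<subseteq> topspace X" using S x0 by auto
      obtain i where i: "i \<ge> M c" "insert x0 S \<subseteq> U i"
        using omega_cover_tail[OF U(1) S', of "M c"] by (elim exE conjE)
      obtain i' where i': "i' \<ge> M (Suc i)" "insert x0 S \<subseteq> U i'"
        using omega_cover_tail[OF U(1) S', of "M (Suc i)"] by (elim exE conjE)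
      have "U i \<inter> U i' \<in> \<A> c"
        unfolding \<A>_def using i i' by blast
      then show ?thesis using i(2) i'(2) by (intro bexI[of _ "U i \<inter> U i'"]) auto
    qed
    have "W \<noteq> {} \<and> W \<subset> topspace X \<and> openin X W" if "W \<in> \<A> c" for W
      using that U_props unfolding \<A>_def by blast
    moreover have "topspace X \<subseteq> \<Union> (\<A> c)"
      using omega[of "{x}" for x] by auto
    ultimately have "is_cover X (\<A> c)" "\<forall>W\<in>\<A> c. openin X W"
      unfolding is_cover_def by blast+
    with omega show ?thesis unfolding open_omega_covers_def by simp
  qed
  with S_fin obtain F where F: "\<forall>c. finite (F c) \<and> F c \<subseteq> \<A> c" "(\<Union>c. F c) \<in> \<B>"
    unfolding S_fin_def by meson
  have A_F: "\<exists>i e i'. W = U i \<inter> U i' \<and> M c \<le> i \<and> i < e \<and> M e \<le> i'" if "W \<in> F c" for W c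
  proof -
    have "W \<in> \<A> c" using F(1) that by blast
    then show ?thesis unfolding \<A>_def by simp
  qed
  obtain d where d: "strict_mono d" and d_F:
    "\<And>c W. W \<in> F c \<Longrightarrow> \<exists>n i. c < d (Suc n) \<and> M (d n) \<le> i \<and> i < d (Suc n) \<and> W \<subseteq> U i"
  proof (rule consecutive_intervals[OF M, of F U], goal_cases)
    case (1 c)
    then show ?case using F(1) by blast
  next
    case (2 c W)
    then show ?case by (intro A_F)
  next
    case (3 d)
    from 3(2-) show ?case by (rule 3(1))
  qed
  obtain a where a: "\<forall>n. ok (history a n)" "\<forall>n. {M (d n)..<d (Suc n)} \<subseteq> a n"
    using play[OF d] by (elim exE conjE)
  have a_F: "\<exists>n i. c < d (Suc n) \<and> i \<in> a n \<and> W \<subseteq> U i" if W: "W \<in> F c" for c W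
  proof -
    obtain n i where "c < d (Suc n)" "M (d n) \<le> i" "i < d (Suc n)" "W \<subseteq> U i"
      using d_F[OF W] by (elim exE conjE)
    moreover from this have "i \<in> a n" using a(2)[rule_format, of n] by auto
    ultimately show ?thesis by blast
  qed
  define \<V> where "\<V> = (\<Union>n. U ` a n)"
  have \<V>: "V \<noteq> {} \<and> V \<subset> topspace X \<and> openin X V" if "V \<in> \<V>" for V
    using that U_props unfolding \<V>_def by blast
  have V_F: "\<exists>V\<in>\<V>. W \<subseteq> V" if W: "W \<in> (\<Union>c. F c)" for W
  proof -
    obtain c where "W \<in> F c" using W by blast
    then obtain n i where "i \<in> a n" "W \<subseteq> U i" using a_F by blast
    then show ?thesis unfolding \<V>_def by blast
  qed
  have "is_cover X (\<Union>c. F c)"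
    using F(2) \<B> by (auto simp: open_large_covers_def open_omega_covers_def)
  then have "topspace X = \<Union> (\<Union>c. F c)" by (simp add: is_cover_def)
  also have "\<dots> \<subseteq> \<Union>\<V>"
    using V_F by (intro Union_subsetI) (simp add: Bex_def)
  finally have "topspace X \<subseteq> \<Union>\<V>" .
  moreover have "\<Union>\<V> \<subseteq> topspace X" using \<V> by blast
  ultimately have "\<Union>\<V> = topspace X" by (rule equalityI[rotated])
  then have cover: "is_cover X \<V>" "\<forall>V\<in>\<V>. openin X V"
    using \<V> by (simp_all add: is_cover_def)
  have "\<V> \<in> \<B>"
  proof (cases "\<B> = open_omega_covers X")
    case True
    have "\<exists>V\<in>\<V>. S \<subseteq> V" if S: "finite S" "S \<subseteq> topspace X" for S
    proof -
      have om: "\<forall>S. finite S \<and> S \<subseteq> topspace X \<longrightarrow> (\<exists>W\<in>(\<Union>c. F c). S \<subseteq> W)"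
        using F(2) by (simp add: True open_omega_covers_def)
      obtain W where W: "W \<in> (\<Union>c. F c)" "S \<subseteq> W"
        by (rule bexE[OF om[rule_format, OF conjI[OF S]]])
      obtain V where "V \<in> \<V>" "W \<subseteq> V" by (rule bexE[OF V_F[OF W(1)]])
      then show ?thesis using W(2) by (intro bexI[of _ V]) auto
    qed
    with cover show ?thesis unfolding True open_omega_covers_def by simp
  next
    case False
    then have large: "\<B> = open_large_covers X" using \<B> by blast
    have "infinite {V \<in> \<V>. x \<in> V}" if x: "x \<in> topspace X" for x
    proof
      \<comment> \<open>Injectivity of \<open>U\<close> leaves finitely many indices at
        \<open>x\<close>, and disjointness of the blocks bounds their positions by some
        \<open>N\<close>. All selected sets containing \<open>x\<close> then come from the finitely
        many finite \<open>F c\<close> with \<open>c < d N\<close>, against largeness.\<close>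
      assume fin: "finite {V \<in> \<V>. x \<in> V}"
      define I where "I = {i. x \<in> U i \<and> (\<exists>n. i \<in> a n)}"
      have "U ` I \<subseteq> {V \<in> \<V>. x \<in> V}" unfolding I_def \<V>_def by blast
      then have "finite (U ` I)" using fin by (rule finite_subset)
      then have "finite I" by (rule finite_imageD) (rule inj_on_subset[OF U(2) subset_UNIV])
      have "disjoint_family a" using disj a(1) by blast
      have "finite {n. i \<in> a n}" for i
      proof (cases "\<exists>n. i \<in> a n")
        case True
        then obtain n where "i \<in> a n" ..
        then have "{n. i \<in> a n} \<subseteq> {n}"
          using \<open>disjoint_family a\<close> unfolding disjoint_family_on_def by blast
        then show ?thesis by (rule finite_subset) simp
      qed simp
      then have "finite (\<Union>i\<in>I. {n. i \<in> a n})" using \<open>finite I\<close> by blast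
      then obtain N where N: "\<forall>n\<in>(\<Union>i\<in>I. {n. i \<in> a n}). n < N"
        using finite_nat_set_iff_bounded by blast
      have "W \<in> (\<Union>c<d N. F c)" if W: "W \<in> F c" "x \<in> W" for c W
      proof -
        obtain n i where ni: "c < d (Suc n)" "i \<in> a n" "W \<subseteq> U i" using a_F[OF W(1)] by blast
        then have "i \<in> I" using W(2) unfolding I_def by blast
        then have "n < N" using N ni(2) by blast
        then have "d (Suc n) \<le> d N" using d by (simp add: strict_mono_less_eq)
        then show ?thesis using ni(1) W(1) by auto
      qed
      then have "{W \<in> \<Union>c. F c. x \<in> W} \<subseteq> (\<Union>c<d N. F c)" by blast
      then have "finite {W \<in> \<Union>c. F c. x \<in> W}"
        by (rule finite_subset) (use F(1) in blast)
      moreover have "infinite {W \<in> \<Union>c. F c. x \<in> W}"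
        using F(2) x unfolding large open_large_covers_def mem_Collect_eq by metis
      ultimately show False by contradiction
    qed
    with cover show ?thesis unfolding large open_large_covers_def by simp
  qed
  then show thesis using that[of a] a(1) unfolding \<V>_def by blast
qed

section \<open>Passage from index blocks to families of open sets\<close>

theorem theorem4p2:
  fixes X :: "'a topology"
    and \<B> :: "'a set set set"
    and \<U> :: "'a set set"
    and k :: nat
    and \<gamma> :: "'a set set \<Rightarrow> nat"
  assumes "infinite (topspace X)"
    and "metrizable_space X"
    and "separable_space X"
    and "\<B> \<in> {open_large_covers X, open_omega_covers X}"
    and "S_fin (open_omega_covers X) \<B>"
    and "coloring (nsets {U. openin X U} 2) k \<gamma>"
    and "\<U> \<in> open_omega_covers X"
    and "\<not> (\<exists>\<V>. finite \<V> \<and> \<V> \<subseteq> \<U> \<and> is_cover X \<V>)"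
  shows "\<exists>\<F> :: nat \<Rightarrow> 'a set set.
           (\<forall>n. \<F> n \<in> Fin \<U>) \<and>
           disjoint_family \<F> \<and>
           (\<Union>n. \<F> n) \<in> \<B> \<and>
           proper_seq (\<lambda>n. \<Union>(\<F> n)) \<and>
           monochromatic_subset (nsets {U. openin X U} 2) \<gamma> (sumgraph (\<lambda>n. \<Union>(\<F> n)))"
proof -
  have "second_countable X"
    by (rule metrizable_separable_imp_second_countable[OF assms(2,3)])
  then obtain \<V> where \<V>: "countable \<V>" "\<V> \<subseteq> \<U>" "\<V> \<in> open_omega_covers X"
    using countable_omega_subcover[OF _ assms(7)] by blast
  have "is_cover X \<V>" using \<V>(3) by (simp add: open_omega_covers_def)
  then have "infinite \<V>" using assms(8) \<V>(2) by blast
  define U where "U = from_nat_into \<V>"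
  have "bij_betw U UNIV \<V>" unfolding U_def by (rule bij_betw_from_nat_into[OF \<V>(1) \<open>infinite \<V>\<close>])
  then have U: "range U = \<V>" "inj U" by (auto simp: bij_betw_def)
  have U_props: "U i \<in> \<U>" "U i \<noteq> {}" "U i \<subset> topspace X" "openin X (U i)" for i
  proof -
    have "U i \<in> \<V>" using U(1) by blast
    then show "U i \<in> \<U>" "U i \<noteq> {}" "U i \<subset> topspace X" "openin X (U i)"
      using \<V>(2,3) by (auto simp: open_omega_covers_def is_cover_def)
  qed
  define V where "V a = \<Union> (U ` a)" for a
  have V_open: "openin X (V a)" for a unfolding V_def using U_props(4) by blast
  have edge: "{V a, V b} \<in> nsets {U. openin X U} 2" if "V a \<noteq> V b" for a b
    using that V_open by (simp add: nsets_def)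
  have color: "\<gamma> {V a, V b} \<in> {1..k}" if "V a \<noteq> V b" for a b
    using edge[OF that] assms(6) unfolding coloring_def by blast
  \<comment> \<open>The extra color 0 marks the pairs that violate properness.\<close>
  define col where "col a b = (if V a = V b then 0 else \<gamma> {V a, V b})" for a b
  have "col a b \<le> k" for a b
    using color[of a b] by (auto simp: col_def)
  then obtain i ok where ok: "ok []" "\<And>s. ok s \<Longrightarrow> \<exists>m. \<forall>j. \<exists>a. ok (a # s) \<and> {m..<j} \<subseteq> a"
    and fin: "\<And>a n. (\<And>n. ok (history a n)) \<Longrightarrow> finite (a n) \<and> a n \<noteq> {}"
    and disj: "\<And>a. (\<And>n. ok (history a n)) \<Longrightarrow> disjoint_family a"
    and mono: "\<And>a H K. (\<And>n. ok (history a n)) \<Longrightarrow> H \<in> Fin UNIV \<Longrightarrow> K \<in> Fin UNIV \<Longrightarrow>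
      block_less H K \<Longrightarrow> col (\<Union> (a ` H)) (\<Union> (a ` K)) = i"
  proof (rule Milliken_Taylor_positions[of col k], goal_cases)
    case (1 i ok)
    from 1(2-) show ?case by (rule 1(1))
  qed
  obtain a where a: "\<And>n. ok (history a n)" "(\<Union>n. U ` a n) \<in> \<B>"
    by (rule selective_play[of \<B> X U ok, OF assms(4,5) _ U(2) ok disj]) (use \<V>(3) U(1) in auto)
  define \<F> where "\<F> n = U ` a n" for n
  have bu: "block_union (\<lambda>n. \<Union> (\<F> n)) H = V (\<Union> (a ` H))" for H
    by (auto simp: block_union_def \<F>_def V_def)
  have "i \<noteq> 0"
  proof
    assume "i = 0"
    have const: "V (a n) = V (a 0)" for n
    proof (cases "n = 0")
      case False
      then have "col (\<Union> (a ` {0})) (\<Union> (a ` {n})) = i"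
        by (intro mono a(1)) (auto simp: Fin_def block_less_def)
      \<comment> \<open>On pairs of distinct open sets \<open>\<gamma>\<close> is at least 1, so
        color 0 forces equal unions.\<close>
      then show ?thesis using \<open>i = 0\<close> color[of "a 0" "a n"]
        by (cases "V (a 0) = V (a n)") (simp_all add: col_def)
    qed simp
    have "is_cover X (\<Union>n. U ` a n)"
      using a(2) assms(4) by (auto simp: open_large_covers_def open_omega_covers_def)
    then have "topspace X = \<Union> (\<Union>n. U ` a n)" by (simp add: is_cover_def)
    then have "topspace X = (\<Union>n. V (a n))" unfolding V_def by blast
    also have "\<dots> = V (a 0)" using const by blast
    finally have "\<Union> (U ` a 0) = topspace X" by (simp add: V_def)
    then have "is_cover X (U ` a 0)" using U_props(2,3) by (simp add: is_cover_def)
    moreover have "finite (U ` a 0)" "U ` a 0 \<subseteq> \<U>" using fin[OF a(1)] U_props(1) by auto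
    ultimately show False using assms(8) by blast
  qed
  have *: "V (\<Union> (a ` H)) \<noteq> V (\<Union> (a ` K)) \<and> \<gamma> {V (\<Union> (a ` H)), V (\<Union> (a ` K))} = i"
    if "H \<in> Fin UNIV" "K \<in> Fin UNIV" "block_less H K" for H K
    using mono[OF a(1) that] \<open>i \<noteq> 0\<close> by (auto simp: col_def split: if_splits)
  show ?thesis
  proof (intro exI[of _ \<F>] conjI allI)
    show "\<F> n \<in> Fin \<U>" for n
      using fin[OF a(1), of n] U_props(1) by (auto simp: Fin_def \<F>_def)
    \<comment> \<open>Disjoint index blocks give disjoint families because \<open>U\<close> is
      injective.\<close>
    show "disjoint_family \<F>"
      using disj[OF a(1)] unfolding disjoint_family_on_def \<F>_def
      by (simp add: image_Int[OF U(2), symmetric])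
    show "(\<Union>n. \<F> n) \<in> \<B>" using a(2) by (simp add: \<F>_def)
    show "proper_seq (\<lambda>n. \<Union> (\<F> n))"
      using * by (simp add: proper_seq_def bu)
    have "sumgraph (\<lambda>n. \<Union> (\<F> n)) \<subseteq> nsets {U. openin X U} 2"
      using * edge unfolding sumgraph_def bu by blast
    moreover have "\<gamma> e = i" if "e \<in> sumgraph (\<lambda>n. \<Union> (\<F> n))" for e
      using * that unfolding sumgraph_def bu by blast
    ultimately show "monochromatic_subset (nsets {U. openin X U} 2) \<gamma> (sumgraph (\<lambda>n. \<Union> (\<F> n)))"
      unfolding monochromatic_subset_def constant_on_def by blast
  qed
qed

end
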